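(* Let $R$ be a reduced commutative ring with identity having exactly $n\ge 3$ minimal prime ideals ($n$ a positive integer), and assume $\alpha_{\max}\ge 2$. Let $x\in Z(R)^*$. Then $\deg(x)=\delta(W\Gamma(R))$ if and only if $x\in\gamma_i$ for some $i\in S$.
   Context: Weakly zero-divisor graph: for a commutative ring $R$ with identity, $Z(R)$ is the set of zero-divisors (elements $x$ with $xy=0$ for some $y\ne 0$), $Z(R)^*=Z(R)\setminus\{0\}$, and $\mathrm{ann}(x)=\{r\in R: rx=0\}$. $W\Gamma(R)$ is the simple undirected graph with vertex set $Z(R)^*$ in which two distinct vertices $x,y$ are adjacent if and only if there exist nonzero $w\in\mathrm{ann}(x)$ and nonzero $z\in\mathrm{ann}(y)$ with $wz=0$. Minimal primes: a ring is reduced if it has no nonzero nilpotent elements. $\mathrm{Min}(R)=\{\mathfrak p_1,\dots,\mathfrak p_n\}$ is the set of minimal prime ideals of $R$. For $1\le i\le n$, $\gamma_i:=\mathfrak p_i\setminus\bigcup_{j\ne i}\mathfrak p_j$; $\alpha_{\max}:=\max\{|\gamma_i|:1\le i\le n\}$; and $S:=\{j:|\gamma_j|=\alpha_{\max}\}$. Degrees: $\deg(x)$ is the cardinality of the set of neighbours of $x$ in $W\Gamma(R)$, and $\delta(W\Gamma(R))$ is the minimum degree of a vertex.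
   Formalization: The formal theorem additionally assumes that α_max is finite (equivalently, R is finite); for every infinite R the stated equivalence fails, e.g. R = Q×Q×Q and x = (0,0,1), where all degrees are equal but x lies in no γ_i. *)

theory Defs
  imports "HOL-Algebra.Algebra" "HOL-Library.Extended_Nat"
begin

text \<open>Cardinality in the extended naturals; \<open>card\<close> alone would give infinite sets the value 0.\<close>

definition ecard :: "'a set \<Rightarrow> enat" where
  "ecard A = (if finite A then enat (card A) else \<infinity>)"

definition zero_divisors :: "('a, 'b) ring_scheme \<Rightarrow> 'a set" where
  "zero_divisors R = {x \<in> carrier R. \<exists>y \<in> carrier R. y \<noteq> \<zero>\<^bsub>R\<^esub> \<and> x \<otimes>\<^bsub>R\<^esub> y = \<zero>\<^bsub>R\<^esub>}"

definition nonzero_zero_divisors :: "('a, 'b) ring_scheme \<Rightarrow> 'a set" where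
  "nonzero_zero_divisors R = zero_divisors R - {\<zero>\<^bsub>R\<^esub>}"

definition ann :: "('a, 'b) ring_scheme \<Rightarrow> 'a \<Rightarrow> 'a set" where
  "ann R x = {r \<in> carrier R. r \<otimes>\<^bsub>R\<^esub> x = \<zero>\<^bsub>R\<^esub>}"

definition reduced :: "('a, 'b) ring_scheme \<Rightarrow> bool" where
  "reduced R \<longleftrightarrow>
     (\<forall>x \<in> carrier R. (\<exists>k::nat. k \<ge> 1 \<and> x [^]\<^bsub>R\<^esub> k = \<zero>\<^bsub>R\<^esub>) \<longrightarrow> x = \<zero>\<^bsub>R\<^esub>)"

definition minimal_primes :: "('a, 'b) ring_scheme \<Rightarrow> 'a set set" where
  "minimal_primes R =
     {P. primeideal P R \<and> (\<forall>Q. primeideal Q R \<longrightarrow> Q \<subseteq> P \<longrightarrow> Q = P)}"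

text \<open>The weakly zero-divisor graph, with vertex set \<^term>\<open>nonzero_zero_divisors R\<close>.\<close>

definition wzd_adj :: "('a, 'b) ring_scheme \<Rightarrow> 'a \<Rightarrow> 'a \<Rightarrow> bool" where
  "wzd_adj R x y \<longleftrightarrow>
     x \<in> nonzero_zero_divisors R \<and> y \<in> nonzero_zero_divisors R \<and> x \<noteq> y \<and>
     (\<exists>w \<in> ann R x - {\<zero>\<^bsub>R\<^esub>}. \<exists>z \<in> ann R y - {\<zero>\<^bsub>R\<^esub>}. w \<otimes>\<^bsub>R\<^esub> z = \<zero>\<^bsub>R\<^esub>)"

definition wzd_degree :: "('a, 'b) ring_scheme \<Rightarrow> 'a \<Rightarrow> enat" where
  "wzd_degree R x = ecard {y. wzd_adj R x y}"

text \<open>\<^typ>\<open>enat\<close> is well-ordered, so the infimum is attained whenever there is a vertex.\<close>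

definition wzd_min_degree :: "('a, 'b) ring_scheme \<Rightarrow> enat" where
  "wzd_min_degree R = (INF x \<in> nonzero_zero_divisors R. wzd_degree R x)"

text \<open>Below, \<open>p 1, \<dots>, p n\<close> is a repetition-free enumeration of the minimal primes.\<close>

definition prime_gamma :: "nat \<Rightarrow> (nat \<Rightarrow> 'a set) \<Rightarrow> nat \<Rightarrow> 'a set" where
  "prime_gamma n p i = p i - (\<Union>j \<in> {1..n} - {i}. p j)"

definition alpha_max :: "nat \<Rightarrow> (nat \<Rightarrow> 'a set) \<Rightarrow> enat" where
  "alpha_max n p = Max ((\<lambda>i. ecard (prime_gamma n p i)) ` {1..n})"

definition max_indices :: "nat \<Rightarrow> (nat \<Rightarrow> 'a set) \<Rightarrow> nat set" where
  "max_indices n p = {j \<in> {1..n}. ecard (prime_gamma n p j) = alpha_max n p}"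

end

theory Submission
  imports Defs
begin

text \<open>
  The minimal primes of a reduced ring intersect in \<open>0\<close> (lemma \<open>minimal_prime_avoiding\<close>), so
  whether a product vanishes can be read off from the minimal primes that contain its factors. When
  there are finitely many of them, every pattern of membership occurs: pairwise incomparable primes
  admit separators \<open>e\<^sub>i\<close> lying in every \<open>p\<^sub>j\<close> except \<open>p\<^sub>i\<close> (lemma \<open>separator\<close>), and sums of separators
  realise all other patterns (lemma \<open>prescribed_membership\<close>).

  If \<open>x \<in> p\<^sub>i\<close> and \<open>y \<in> p\<^sub>j\<close> with \<open>i \<noteq> j\<close>, then \<open>e\<^sub>i\<close> annihilates \<open>x\<close>, \<open>e\<^sub>j\<close> annihilates \<open>y\<close> and
  \<open>e\<^sub>i e\<^sub>j = 0\<close>, so that \<open>x\<close> and \<open>y\<close> are adjacent. Hence distinct vertices fail to be adjacent only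
  when both lie in one minimal prime and in no other, that is, in a common \<open>\<gamma>\<^sub>i\<close>; and in that case
  they do fail to be, because nonzero annihilators of elements of \<open>\<gamma>\<^sub>i\<close> lie outside the prime \<open>p\<^sub>i\<close>
  (lemma \<open>wzd_adj_iff\<close>). So \<open>W\<Gamma>(R)\<close> is the complement of the disjoint union of the complete graphs
  on the \<open>\<gamma>\<^sub>i\<close> and isolated vertices: with \<open>N\<close> vertices in all, a vertex in \<open>\<gamma>\<^sub>i\<close> has degree
  \<open>N - |\<gamma>\<^sub>i|\<close> and a vertex in no \<open>\<gamma>\<^sub>i\<close> has degree \<open>N - 1\<close>. As \<open>\<alpha>\<^sub>m\<^sub>a\<^sub>x \<ge> 2\<close>, the minimum is
  \<open>N - \<alpha>\<^sub>m\<^sub>a\<^sub>x\<close>, attained exactly on the largest \<open>\<gamma>\<^sub>i\<close>.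

  The comparison of these differences needs \<open>N\<close> finite, whereas only the \<open>\<gamma>\<^sub>i\<close> are known to be. This
  gap is closed by lemma \<open>finite_carrier\<close>: a translate of each \<open>e\<^sub>j R - {0}\<close> sits inside some \<open>\<gamma>\<^sub>i\<close>,
  and \<open>r \<mapsto> (e\<^sub>j r)\<^sub>j\<close> is injective, so finiteness of the \<open>\<gamma>\<^sub>i\<close> forces \<open>R\<close> itself to be finite.
\<close>

section \<open>Minimal primes of a reduced ring\<close>

lemma (in cring) reduced_annihilator_of_power:
  assumes "reduced R" "m \<in> carrier R" "a \<in> carrier R" "m \<otimes> a [^] (k::nat) = \<zero>"
  shows "m \<otimes> a = \<zero>"
proof -
  have "(m \<otimes> a) [^] Suc k = (m [^] k \<otimes> a) \<otimes> (m \<otimes> a [^] k)"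
    using assms(2,3) by (simp add: nat_pow_distrib m_ac)
  also have "\<dots> = \<zero>"
    using assms by simp
  finally have "\<exists>k::nat. k \<ge> 1 \<and> (m \<otimes> a) [^] k = \<zero>"
    by (intro exI[of _ "Suc k"]) simp
  then show ?thesis
    using assms unfolding reduced_def by blast
qed

text \<open>
  The prime is the complement of a maximal multiplicative set \<open>M\<close> that contains \<open>x\<close> but not \<open>0\<close>.
  Enlarging \<open>M\<close> by an element \<open>a \<notin> M\<close> must produce \<open>0\<close>, and reducedness turns this into
  \<open>m a = 0\<close> for some \<open>m \<in> M\<close>. The complement is thus the set of elements killed by \<open>M\<close>, which makes
  it an ideal and puts it inside every prime disjoint from \<open>M\<close>, so minimality comes for free.
\<close>

lemma (in cring) minimal_prime_avoiding:
  assumes red: "reduced R" and x: "x \<in> carrier R" "x \<noteq> \<zero>"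
  shows "\<exists>P \<in> minimal_primes R. x \<notin> P"
proof -
  define \<A> where "\<A> = {M. M \<subseteq> carrier R \<and> \<zero> \<notin> M \<and> \<one> \<in> M \<and> x \<in> M \<and>
    (\<forall>a\<in>M. \<forall>b\<in>M. a \<otimes> b \<in> M)}"
  have "range (\<lambda>k::nat. x [^] k) \<in> \<A>"
  proof -
    have "x [^] k \<noteq> \<zero>" for k :: nat
      using reduced_annihilator_of_power[OF red one_closed x(1), of k] x by auto
    moreover have "\<one> \<in> range (\<lambda>k::nat. x [^] k)"
      by (rule range_eqI[of _ _ 0]) simp
    moreover have "x \<in> range (\<lambda>k::nat. x [^] k)"
      using x(1) by (intro range_eqI[of _ _ 1]) simp
    ultimately show ?thesis
      unfolding \<A>_def using x(1) by (force simp: nat_pow_mult)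
  qed
  then have "\<A> \<noteq> {}"
    by blast
  moreover have "\<Union>\<C> \<in> \<A>" if C: "\<C> \<noteq> {}" "subset.chain \<A> \<C>" for \<C>
  proof -
    have sub: "\<C> \<subseteq> \<A>"
      using C(2) by (simp add: subset_chain_def)
    have "a \<otimes> b \<in> \<Union>\<C>" if "a \<in> \<Union>\<C>" "b \<in> \<Union>\<C>" for a b
    proof -
      obtain A B where AB: "A \<in> \<C>" "a \<in> A" "B \<in> \<C>" "b \<in> B"
        using \<open>a \<in> \<Union>\<C>\<close> \<open>b \<in> \<Union>\<C>\<close> by blast
      then have "A \<subseteq> B \<or> B \<subseteq> A"
        using C(2) by (auto simp: subset_chain_def)
      then obtain D where "D \<in> \<C>" "a \<in> D" "b \<in> D"
        using AB by blast
      then show ?thesis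
        using sub unfolding \<A>_def by blast
    qed
    moreover have "\<one> \<in> \<Union>\<C>" "x \<in> \<Union>\<C>" "\<Union>\<C> \<subseteq> carrier R" "\<zero> \<notin> \<Union>\<C>"
      using sub C(1) unfolding \<A>_def by blast+
    ultimately show ?thesis
      unfolding \<A>_def by simp
  qed
  ultimately obtain M where M: "M \<in> \<A>" and max: "\<And>Y. Y \<in> \<A> \<Longrightarrow> M \<subseteq> Y \<Longrightarrow> Y = M"
    using subset_Zorn_nonempty[of \<A>] by metis
  have sub: "M \<subseteq> carrier R" and zero: "\<zero> \<notin> M" and one: "\<one> \<in> M" and "x \<in> M"
    and mult: "\<And>a b. a \<in> M \<Longrightarrow> b \<in> M \<Longrightarrow> a \<otimes> b \<in> M"
    using M unfolding \<A>_def by auto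
  have killed: "\<exists>m\<in>M. m \<otimes> a = \<zero>" if a: "a \<in> carrier R" "a \<notin> M" for a
  proof (rule ccontr)
    assume no: "\<not> ?thesis"
    \<comment> \<open>The multiplicative set generated by \<open>M\<close> and \<open>a\<close>.\<close>
    define Y where "Y = {m \<otimes> a [^] k | m (k::nat). m \<in> M}"
    have "Y \<subseteq> carrier R"
      using sub a unfolding Y_def by auto
    moreover have "\<zero> \<notin> Y"
    proof
      assume "\<zero> \<in> Y"
      then obtain m k where m: "m \<in> M" "m \<otimes> a [^] (k::nat) = \<zero>"
        unfolding Y_def by auto
      then show False
        using reduced_annihilator_of_power[OF red _ a(1)] no sub by blast
    qed
    moreover have MX: "M \<subseteq> Y"
    proof
      fix m assume "m \<in> M"
      moreover have "m = m \<otimes> a [^] (0::nat)"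
        using \<open>m \<in> M\<close> sub by auto
      ultimately show "m \<in> Y"
        unfolding Y_def by blast
    qed
    moreover have "u \<otimes> v \<in> Y" if uv: "u \<in> Y" "v \<in> Y" for u v
    proof -
      obtain m k m' k' where *: "m \<in> M" "m' \<in> M" "u = m \<otimes> a [^] (k::nat)"
          "v = m' \<otimes> a [^] (k'::nat)"
        using uv unfolding Y_def by auto
      have "m \<in> carrier R" "m' \<in> carrier R"
        using * sub by auto
      then have "u \<otimes> v = (m \<otimes> m') \<otimes> (a [^] k \<otimes> a [^] k')"
        using a(1) by (simp add: * m_ac)
      then have "u \<otimes> v = (m \<otimes> m') \<otimes> a [^] (k + k')"
        using a(1) by (simp add: nat_pow_mult)
      then show ?thesis
        using mult * unfolding Y_def by blast
    qed
    ultimately have "Y \<in> \<A>"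
      using one \<open>x \<in> M\<close> unfolding \<A>_def by blast
    then have "Y = M"
      using max MX by blast
    moreover have "a \<in> Y"
    proof -
      have "a = \<one> \<otimes> a [^] (1::nat)"
        using a by simp
      then show ?thesis
        using one unfolding Y_def by blast
    qed
    ultimately show False
      using a by simp
  qed
  define P where "P = carrier R - M"
  have P_iff: "a \<in> P \<longleftrightarrow> a \<in> carrier R \<and> (\<exists>m\<in>M. m \<otimes> a = \<zero>)" for a
    unfolding P_def using killed mult zero by (metis Diff_iff)
  have P_mult: "c \<otimes> a \<in> P" if ca: "c \<in> carrier R" "a \<in> P" for c a
  proof -
    obtain m where m: "m \<in> M" "m \<otimes> a = \<zero>" and a: "a \<in> carrier R"
      using ca P_iff by blast
    have "m \<otimes> (c \<otimes> a) = c \<otimes> (m \<otimes> a)"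
      using m(1) sub a ca by (auto intro: m_lcomm)
    then show ?thesis
      using m a ca P_iff by auto
  qed
  have P_add: "a \<oplus> b \<in> P" if ab: "a \<in> P" "b \<in> P" for a b
  proof -
    obtain m m' where m: "m \<in> M" "m \<otimes> a = \<zero>" "m' \<in> M" "m' \<otimes> b = \<zero>"
      and c: "a \<in> carrier R" "b \<in> carrier R"
      using ab P_iff by metis
    have "(m \<otimes> m') \<otimes> (a \<oplus> b) = m' \<otimes> (m \<otimes> a) \<oplus> m \<otimes> (m' \<otimes> b)"
      using m(1,3) sub c by (simp add: m_ac r_distr subset_iff)
    also have "\<dots> = \<zero>"
      using m sub by (simp add: subset_iff)
    finally show ?thesis
      using mult m c P_iff by auto
  qed
  have P_minus: "\<ominus> a \<in> P" if "a \<in> P" for a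
  proof -
    have "\<ominus> a = (\<ominus> \<one>) \<otimes> a"
      using that unfolding P_def by (simp add: l_minus)
    then show ?thesis
      using P_mult[of "\<ominus> \<one>" a] that by simp
  qed
  have "subgroup P (add_monoid R)"
    using zero P_add P_minus by (intro add.subgroupI) (auto simp: P_def a_inv_def)
  moreover have "a \<otimes> c \<in> P" if "c \<in> carrier R" "a \<in> P" for c a
    using P_mult[OF that] that m_comm[of a c] by (simp add: P_def)
  ultimately have "ideal P R"
    using P_mult by (intro idealI ring_axioms)
  then have "primeideal P R"
    using one mult by (intro primeidealI) (auto simp: P_def is_cring)
  moreover have "Q = P" if Q: "primeideal Q R" "Q \<subseteq> P" for Q
  proof
    interpret Q: primeideal Q R by (rule Q(1))
    show "P \<subseteq> Q"
    proof
      fix a assume "a \<in> P"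
      then obtain m where m: "m \<in> M" "m \<otimes> a = \<zero>" "a \<in> carrier R"
        using P_iff by blast
      have "m \<otimes> a \<in> Q"
        using m by simp
      moreover have "m \<notin> Q"
        using m Q unfolding P_def by blast
      ultimately show "a \<in> Q"
        using Q.I_prime m sub by blast
    qed
  qed (rule Q(2))
  ultimately have "P \<in> minimal_primes R"
    unfolding minimal_primes_def by blast
  then show ?thesis
    using \<open>x \<in> M\<close> unfolding P_def by blast
qed

section \<open>Finitely many incomparable primes with zero intersection\<close>

text \<open>For the minimal primes of a reduced ring, incomparability expresses minimality and the zero
  intersection expresses reducedness. From two primes on, \<open>0\<close> belongs to no \<open>\<gamma>\<^sub>i\<close>.\<close>

locale incomparable_primes = cring R for R (structure) +
  fixes n :: nat and p :: "nat \<Rightarrow> 'a set"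
  assumes two_le: "2 \<le> n"
    and prime: "i \<in> {1..n} \<Longrightarrow> primeideal (p i) R"
    and incomparable: "\<lbrakk>i \<in> {1..n}; j \<in> {1..n}; i \<noteq> j\<rbrakk> \<Longrightarrow> \<not> p i \<subseteq> p j"
    and Inter_zero: "\<lbrakk>a \<in> carrier R; \<And>i. i \<in> {1..n} \<Longrightarrow> a \<in> p i\<rbrakk> \<Longrightarrow> a = \<zero>"
begin

abbreviation \<gamma> where "\<gamma> \<equiv> prime_gamma n p"

lemma p_ideal: "i \<in> {1..n} \<Longrightarrow> ideal (p i) R"
  using prime by (rule primeideal.axioms)

lemma p_carrier: "i \<in> {1..n} \<Longrightarrow> a \<in> p i \<Longrightarrow> a \<in> carrier R"
  using p_ideal ideal.Icarr by metis

lemma zero_in_p: "i \<in> {1..n} \<Longrightarrow> \<zero> \<in> p i"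
  using p_ideal additive_subgroup.zero_closed ideal.axioms(1) by metis

lemma mult_in_p_iff:
  assumes "i \<in> {1..n}" "a \<in> carrier R" "b \<in> carrier R"
  shows "a \<otimes> b \<in> p i \<longleftrightarrow> a \<in> p i \<or> b \<in> p i"
  using assms primeideal.I_prime[OF prime] ideal.I_l_closed[OF p_ideal]
    ideal.I_r_closed[OF p_ideal] by metis

lemma add_in_p_iff:
  assumes i: "i \<in> {1..n}" and "a \<in> carrier R" "b \<in> p i"
  shows "a \<oplus> b \<in> p i \<longleftrightarrow> a \<in> p i"
proof
  interpret ideal "p i" R using i by (rule p_ideal)
  show "a \<oplus> b \<in> p i" if "a \<in> p i"
    using that assms by simp
  assume "a \<oplus> b \<in> p i"
  then have "(a \<oplus> b) \<oplus> (\<ominus> b) \<in> p i"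
    using assms by simp
  also have "(a \<oplus> b) \<oplus> (\<ominus> b) = a"
    using assms Icarr by (simp add: a_assoc r_neg)
  finally show "a \<in> p i" .
qed

text \<open>A product of elements \<open>a\<^sub>j \<in> p\<^sub>j - p\<^sub>i\<close>, one for each \<open>j \<noteq> i\<close>, avoids the prime \<open>p\<^sub>i\<close>.\<close>

lemma separator_exists:
  assumes i: "i \<in> {1..n}"
  shows "\<exists>a\<in>carrier R. \<forall>j\<in>{1..n}. a \<in> p j \<longleftrightarrow> j \<noteq> i"
proof -
  have "finite J \<Longrightarrow> J \<subseteq> {1..n} - {i} \<Longrightarrow> \<exists>a\<in>carrier R. a \<notin> p i \<and> (\<forall>j\<in>J. a \<in> p j)" for J
  proof (induction J rule: finite_induct)
    case empty
    have "\<one> \<notin> p i"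
      using ideal.one_imp_carrier[OF p_ideal[OF i]] primeideal.I_notcarr[OF prime[OF i]] by blast
    then show ?case
      by blast
  next
    case (insert j J)
    have j: "j \<in> {1..n}" "j \<noteq> i" and J: "J \<subseteq> {1..n} - {i}"
      using insert.prems by blast+
    obtain a where a: "a \<in> carrier R" "a \<notin> p i" "\<forall>j\<in>J. a \<in> p j"
      using insert.IH[OF J] by blast
    obtain b where b: "b \<in> p j" "b \<notin> p i"
      using incomparable[OF j(1) i j(2)] by blast
    have bR: "b \<in> carrier R"
      using p_carrier[OF j(1) b(1)] .
    have "a \<otimes> b \<notin> p i"
      using a b mult_in_p_iff[OF i a(1) bR] by blast
    moreover have "a \<otimes> b \<in> p k" if "k \<in> insert j J" for k
      using that j J a b mult_in_p_iff[OF _ a(1) bR, of k] by blast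
    ultimately show ?case
      using a(1) bR m_closed by blast
  qed
  from this[of "{1..n} - {i}"] show ?thesis
    by blast
qed

definition e :: "nat \<Rightarrow> 'a" where
  "e i = (SOME a. a \<in> carrier R \<and> (\<forall>j\<in>{1..n}. a \<in> p j \<longleftrightarrow> j \<noteq> i))"

lemma separator:
  assumes "i \<in> {1..n}"
  shows "e i \<in> carrier R" "j \<in> {1..n} \<Longrightarrow> e i \<in> p j \<longleftrightarrow> j \<noteq> i"
proof -
  have "e i \<in> carrier R \<and> (\<forall>j\<in>{1..n}. e i \<in> p j \<longleftrightarrow> j \<noteq> i)"
    unfolding e_def by (rule someI_ex[OF separator_exists[OF assms, unfolded Bex_def]])
  then show "e i \<in> carrier R" "j \<in> {1..n} \<Longrightarrow> e i \<in> p j \<longleftrightarrow> j \<noteq> i"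
    by blast+
qed

lemma separator_nonzero: "i \<in> {1..n} \<Longrightarrow> e i \<noteq> \<zero>"
  using separator zero_in_p by metis

lemma separator_mult_eq_zero_iff:
  assumes "i \<in> {1..n}" "a \<in> carrier R"
  shows "e i \<otimes> a = \<zero> \<longleftrightarrow> a \<in> p i"
proof
  show "a \<in> p i" if "e i \<otimes> a = \<zero>"
    using that assms separator zero_in_p mult_in_p_iff by metis
  show "e i \<otimes> a = \<zero>" if "a \<in> p i"
    using that assms separator[OF assms(1)] by (intro Inter_zero) (auto simp: mult_in_p_iff)
qed

text \<open>The element is the sum of the separators \<open>e\<^sub>k\<close> over \<open>k \<in> A\<close>: modulo \<open>p\<^sub>k\<close> only the term
  \<open>e\<^sub>k\<close> survives.\<close>

lemma prescribed_membership:
  assumes "A \<subseteq> {1..n}"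
  shows "\<exists>b\<in>carrier R. \<forall>k\<in>{1..n}. b \<in> p k \<longleftrightarrow> k \<notin> A"
proof -
  have "finite A"
    using assms finite_subset by blast
  then show ?thesis
    using assms
  proof (induction A rule: finite_induct)
    case empty
    show ?case
      using zero_in_p by blast
  next
    case (insert a A)
    then obtain b where b: "b \<in> carrier R" "\<And>k. k \<in> {1..n} \<Longrightarrow> b \<in> p k \<longleftrightarrow> k \<notin> A"
      by auto
    have a: "a \<in> {1..n}"
      using insert by simp
    have "b \<oplus> e a \<in> p k \<longleftrightarrow> k \<notin> insert a A" if k: "k \<in> {1..n}" for k
    proof (cases "k = a")
      case True
      then have "e a \<oplus> b \<notin> p k"
        using b(2)[OF k] insert(2) separator[OF a] k add_in_p_iff by metis
      then show ?thesis
        using True b separator[OF a] by (simp add: a_comm)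
    next
      case False
      then show ?thesis
        using add_in_p_iff[OF k b(1)] separator[OF a] k b by auto
    qed
    then show ?case
      using b(1) separator(1)[OF a] by blast
  qed
qed

section \<open>Vertices, adjacency and degrees\<close>

lemma nonzero_zero_divisors_iff:
  "x \<in> nonzero_zero_divisors R \<longleftrightarrow> x \<noteq> \<zero> \<and> (\<exists>i\<in>{1..n}. x \<in> p i)"
proof -
  have "x \<in> zero_divisors R \<longleftrightarrow> (\<exists>i\<in>{1..n}. x \<in> p i)"
  proof
    assume "x \<in> zero_divisors R"
    then obtain y where y: "x \<in> carrier R" "y \<in> carrier R" "y \<noteq> \<zero>" "x \<otimes> y = \<zero>"
      unfolding zero_divisors_def by blast
    then obtain i where "i \<in> {1..n}" "y \<notin> p i"
      using Inter_zero by blast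
    then show "\<exists>i\<in>{1..n}. x \<in> p i"
      using y mult_in_p_iff zero_in_p by metis
  next
    assume "\<exists>i\<in>{1..n}. x \<in> p i"
    then obtain i where i: "i \<in> {1..n}" "x \<in> p i" by blast
    then have "x \<otimes> e i = \<zero>"
      using separator_mult_eq_zero_iff separator p_carrier m_comm by metis
    then show "x \<in> zero_divisors R"
      using i p_carrier separator(1) separator_nonzero unfolding zero_divisors_def by blast
  qed
  then show ?thesis
    unfolding nonzero_zero_divisors_def by auto
qed

lemma gamma_iff:
  "i \<in> {1..n} \<Longrightarrow> x \<in> \<gamma> i \<longleftrightarrow> x \<in> carrier R \<and> (\<forall>j\<in>{1..n}. x \<in> p j \<longleftrightarrow> j = i)"
  unfolding prime_gamma_def using p_carrier by blast

lemma other_index: "\<exists>j\<in>{1..n}. j \<noteq> i"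
proof (cases "i = 1")
  case True
  then show ?thesis
    using two_le by (intro bexI[of _ 2]) auto
next
  case False
  then show ?thesis
    using two_le by (intro bexI[of _ 1]) auto
qed

lemma gamma_vertex:
  assumes "i \<in> {1..n}" "x \<in> \<gamma> i"
  shows "x \<in> nonzero_zero_divisors R"
  using assms other_index[of i] zero_in_p
  by (auto simp: nonzero_zero_divisors_iff gamma_iff simp del: atLeastAtMost_iff)

lemma gamma_nonempty:
  assumes "i \<in> {1..n}"
  shows "\<gamma> i \<noteq> {}"
proof -
  obtain b where "b \<in> carrier R" "\<And>k. k \<in> {1..n} \<Longrightarrow> b \<in> p k \<longleftrightarrow> k \<notin> {1..n} - {i}"
    using prescribed_membership[of "{1..n} - {i}"] by blast
  then have "b \<in> \<gamma> i"
    using gamma_iff[OF assms] by blast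
  then show ?thesis
    by blast
qed

lemma gamma_disjoint:
  "\<lbrakk>i \<in> {1..n}; j \<in> {1..n}; x \<in> \<gamma> i; x \<in> \<gamma> j\<rbrakk> \<Longrightarrow> i = j"
  by (metis gamma_iff)

text \<open>
  A nonzero annihilator of an element of \<open>\<gamma>\<^sub>i\<close> lies in every \<open>p\<^sub>j\<close> with \<open>j \<noteq> i\<close> and hence not in
  \<open>p\<^sub>i\<close>; two of these cannot have a product in \<open>p\<^sub>i\<close>. For vertices with no common \<open>\<gamma>\<^sub>i\<close> one can
  choose distinct primes containing them, whose separators witness adjacency.
\<close>

lemma wzd_adj_iff:
  assumes x: "x \<in> nonzero_zero_divisors R" and y: "y \<in> nonzero_zero_divisors R"
  shows "wzd_adj R x y \<longleftrightarrow> x \<noteq> y \<and> \<not> (\<exists>i\<in>{1..n}. x \<in> \<gamma> i \<and> y \<in> \<gamma> i)"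
proof
  assume adj: "wzd_adj R x y"
  then obtain w z where w: "w \<in> carrier R" "w \<noteq> \<zero>" "w \<otimes> x = \<zero>"
    and z: "z \<in> carrier R" "z \<noteq> \<zero>" "z \<otimes> y = \<zero>" and wz: "w \<otimes> z = \<zero>"
    unfolding wzd_adj_def ann_def by blast
  have outside: "a \<notin> p i"
    if "i \<in> {1..n}" "u \<in> \<gamma> i" "a \<in> carrier R" "a \<noteq> \<zero>" "a \<otimes> u = \<zero>" for i u a
  proof
    assume "a \<in> p i"
    moreover have "a \<in> p j" if "j \<in> {1..n}" "j \<noteq> i" for j
      using that \<open>i \<in> {1..n}\<close> \<open>u \<in> \<gamma> i\<close> \<open>a \<in> carrier R\<close> \<open>a \<otimes> u = \<zero>\<close> gamma_iff mult_in_p_iff zero_in_p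
      by metis
    ultimately show False
      using Inter_zero that by metis
  qed
  have False if "i \<in> {1..n}" "x \<in> \<gamma> i" "y \<in> \<gamma> i" for i
    using outside[OF that(1,2) w] outside[OF that(1,3) z] wz w z that mult_in_p_iff zero_in_p
    by metis
  then show "x \<noteq> y \<and> \<not> (\<exists>i\<in>{1..n}. x \<in> \<gamma> i \<and> y \<in> \<gamma> i)"
    using adj unfolding wzd_adj_def by blast
next
  assume *: "x \<noteq> y \<and> \<not> (\<exists>i\<in>{1..n}. x \<in> \<gamma> i \<and> y \<in> \<gamma> i)"
  have "\<exists>i\<in>{1..n}. \<exists>j\<in>{1..n}. i \<noteq> j \<and> x \<in> p i \<and> y \<in> p j"
  proof (rule ccontr)
    assume no: "\<not> ?thesis"
    obtain i where i: "i \<in> {1..n}" "x \<in> p i"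
      using x nonzero_zero_divisors_iff by blast
    obtain j where j: "j \<in> {1..n}" "y \<in> p j"
      using y nonzero_zero_divisors_iff by blast
    have "x \<in> \<gamma> i" "y \<in> \<gamma> i"
      using i j no gamma_iff p_carrier by metis+
    then show False
      using * i by blast
  qed
  then obtain i j where ij: "i \<in> {1..n}" "j \<in> {1..n}" "i \<noteq> j" "x \<in> p i" "y \<in> p j"
    by blast
  have "e i \<in> ann R x - {\<zero>}" "e j \<in> ann R y - {\<zero>}"
    using ij separator(1) separator_nonzero separator_mult_eq_zero_iff p_carrier
    unfolding ann_def by auto
  moreover have "e i \<otimes> e j = \<zero>"
    using ij separator separator_mult_eq_zero_iff by metis
  ultimately show "wzd_adj R x y"
    using * x y unfolding wzd_adj_def by blast
qed

lemma neighbours_gamma: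
  assumes i: "i \<in> {1..n}" "x \<in> \<gamma> i"
  shows "{y. wzd_adj R x y} = nonzero_zero_divisors R - \<gamma> i"
proof -
  have "wzd_adj R x y \<longleftrightarrow> y \<in> nonzero_zero_divisors R \<and> y \<notin> \<gamma> i" for y
  proof (cases "y \<in> nonzero_zero_divisors R")
    case True
    show ?thesis
      using wzd_adj_iff[OF gamma_vertex[OF i] True] i gamma_disjoint True by metis
  qed (simp add: wzd_adj_def)
  then show ?thesis by blast
qed

lemma neighbours_outside_gamma:
  assumes "x \<in> nonzero_zero_divisors R" "\<And>i. i \<in> {1..n} \<Longrightarrow> x \<notin> \<gamma> i"
  shows "{y. wzd_adj R x y} = nonzero_zero_divisors R - {x}"
proof -
  have "wzd_adj R x y \<longleftrightarrow> y \<in> nonzero_zero_divisors R \<and> y \<noteq> x" for y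
    using wzd_adj_iff[of x y] assms unfolding wzd_adj_def by metis
  then show ?thesis by blast
qed

text \<open>
  Let \<open>b\<close> lie in exactly \<open>p\<^sub>i\<close> and \<open>p\<^sub>j\<close>. Adding \<open>e\<^sub>j r\<close> with \<open>r \<notin> p\<^sub>j\<close> removes it from \<open>p\<^sub>j\<close> and
  changes no other membership, so \<open>b + e\<^sub>j r \<in> \<gamma>\<^sub>i\<close>; and \<open>e\<^sub>j r = 0\<close> when \<open>r \<in> p\<^sub>j\<close>. Hence
  \<open>e\<^sub>j R\<close>, a copy of \<open>R / p\<^sub>j\<close>, is finite, and \<open>R\<close> embeds in the product of these quotients.
\<close>

lemma finite_carrier:
  assumes fin: "\<And>i. i \<in> {1..n} \<Longrightarrow> finite (\<gamma> i)"
  shows "finite (carrier R)"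
proof -
  have fin_mult: "finite ((\<lambda>r. e j \<otimes> r) ` carrier R)" if j: "j \<in> {1..n}" for j
  proof -
    obtain i where i: "i \<in> {1..n}" "i \<noteq> j"
      using other_index by blast
    obtain b where b: "b \<in> carrier R"
      and bp: "\<And>k. k \<in> {1..n} \<Longrightarrow> b \<in> p k \<longleftrightarrow> k \<notin> {1..n} - {i, j}"
      using prescribed_membership[of "{1..n} - {i, j}"] by blast
    have "e j \<otimes> r \<in> insert \<zero> ((\<lambda>c. c \<ominus> b) ` \<gamma> i)" if r: "r \<in> carrier R" for r
    proof (cases "r \<in> p j")
      case True
      then show ?thesis
        using separator_mult_eq_zero_iff j r by simp
    next
      case False
      let ?s = "e j \<otimes> r"
      have s: "?s \<in> carrier R"
        using r separator(1)[OF j] by simp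
      have sp: "?s \<in> p k \<longleftrightarrow> k \<noteq> j \<or> r \<in> p k" if "k \<in> {1..n}" for k
        using that separator[OF j] r mult_in_p_iff by auto
      have "b \<oplus> ?s \<in> p k \<longleftrightarrow> k = i" if k: "k \<in> {1..n}" for k
      proof (cases "k = j")
        case True
        then have "?s \<oplus> b \<notin> p k"
          using add_in_p_iff[OF k s] sp[OF k] bp[OF k] \<open>r \<notin> p j\<close> by simp
        then show ?thesis
          using True i s b by (simp add: a_comm)
      next
        case False
        then show ?thesis
          using add_in_p_iff[OF k b] sp[OF k] bp[OF k] k by simp
      qed
      then have "b \<oplus> ?s \<in> \<gamma> i"
        using gamma_iff[OF i(1)] b s by simp
      moreover have "?s = (b \<oplus> ?s) \<ominus> b"
        using b s by (simp add: a_minus_def a_ac r_neg2)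
      ultimately show ?thesis
        by blast
    qed
    then have "(\<lambda>r. e j \<otimes> r) ` carrier R \<subseteq> insert \<zero> ((\<lambda>c. c \<ominus> b) ` \<gamma> i)"
      by blast
    then show ?thesis
      using fin[OF i(1)] finite_subset by blast
  qed
  let ?f = "\<lambda>r. \<lambda>j\<in>{1..n}. e j \<otimes> r"
  have "inj_on ?f (carrier R)"
  proof (rule inj_onI)
    fix r s assume rs: "r \<in> carrier R" "s \<in> carrier R" "?f r = ?f s"
    have "r \<ominus> s \<in> p j" if j: "j \<in> {1..n}" for j
    proof -
      have "e j \<otimes> r = e j \<otimes> s"
        using fun_cong[OF rs(3), of j] j by simp
      then have "e j \<otimes> (r \<ominus> s) = \<zero>"
        using rs separator(1)[OF j] by (simp add: a_minus_def r_distr r_minus r_neg)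
      then show ?thesis
        using separator_mult_eq_zero_iff[OF j] rs by simp
    qed
    then have "r \<ominus> s = \<zero>"
      using rs by (intro Inter_zero) auto
    then show "r = s"
      using rs by simp
  qed
  moreover have "finite (?f ` carrier R)"
  proof (rule finite_subset)
    show "?f ` carrier R \<subseteq> (\<Pi>\<^sub>E j\<in>{1..n}. (\<lambda>r. e j \<otimes> r) ` carrier R)"
      by auto
    show "finite (\<Pi>\<^sub>E j\<in>{1..n}. (\<lambda>r. e j \<otimes> r) ` carrier R)"
      using fin_mult by (intro finite_PiE) auto
  qed
  ultimately show ?thesis
    using finite_imageD by blast
qed

text \<open>Vertices outside every \<open>\<gamma>\<^sub>i\<close> miss only themselves, so \<open>\<alpha>\<^sub>m\<^sub>a\<^sub>x \<ge> 2\<close> keeps them away from the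
  minimum.\<close>

lemma degree_minimal_iff:
  assumes ge: "alpha_max n p \<ge> 2" and finite_max: "alpha_max n p \<noteq> \<infinity>"
    and x: "x \<in> nonzero_zero_divisors R"
  shows "wzd_degree R x = wzd_min_degree R \<longleftrightarrow> (\<exists>i \<in> max_indices n p. x \<in> \<gamma> i)"
proof -
  let ?Z = "nonzero_zero_divisors R"
  have le: "ecard (\<gamma> i) \<le> alpha_max n p" if "i \<in> {1..n}" for i
    unfolding alpha_max_def using that by (intro Max_ge) auto
  have fin: "finite (\<gamma> i)" if "i \<in> {1..n}" for i
    using le[OF that] finite_max unfolding ecard_def by (auto split: if_splits)
  have "?Z \<subseteq> carrier R"
    unfolding nonzero_zero_divisors_def zero_divisors_def by blast
  then have finZ: "finite ?Z"
    using finite_carrier[OF fin] finite_subset by blast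
  define N where "N = card ?Z"
  obtain A where A: "alpha_max n p = enat A"
    using finite_max by auto
  have A2: "2 \<le> A"
    using ge unfolding A by (simp add: numeral_eq_enat)
  have ecard_gamma: "ecard (\<gamma> i) = enat (card (\<gamma> i))" if "i \<in> {1..n}" for i
    using fin[OF that] by (simp add: ecard_def)
  have card_le: "card (\<gamma> i) \<le> A" if "i \<in> {1..n}" for i
    using le[OF that] ecard_gamma[OF that] A by simp
  have max_iff: "i \<in> max_indices n p \<longleftrightarrow> i \<in> {1..n} \<and> card (\<gamma> i) = A" for i
    unfolding max_indices_def using ecard_gamma A by auto
  have "alpha_max n p \<in> (\<lambda>i. ecard (\<gamma> i)) ` {1..n}"
    unfolding alpha_max_def using two_le by (intro Max_in) auto
  then obtain m where m: "m \<in> {1..n}" "card (\<gamma> m) = A"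
    using ecard_gamma A by auto
  have AN: "A \<le> N"
    using m(2) finZ gamma_vertex[OF m(1)] unfolding N_def by (metis card_mono subsetI)
  have deg_gamma: "wzd_degree R y = enat (N - card (\<gamma> i))" if "i \<in> {1..n}" "y \<in> \<gamma> i" for i y
  proof -
    have "\<gamma> i \<subseteq> ?Z"
      using gamma_vertex that by blast
    then show ?thesis
      using neighbours_gamma[OF that] finZ fin[OF that(1)]
      by (simp add: wzd_degree_def ecard_def card_Diff_subset N_def)
  qed
  have deg_outside: "wzd_degree R y = enat (N - 1)"
    if "y \<in> ?Z" "\<And>i. i \<in> {1..n} \<Longrightarrow> y \<notin> \<gamma> i" for y
    using neighbours_outside_gamma[OF that] finZ that
    by (simp add: wzd_degree_def ecard_def N_def)
  have deg_ge: "enat (N - A) \<le> wzd_degree R y" if "y \<in> ?Z" for y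
  proof (cases "\<exists>i\<in>{1..n}. y \<in> \<gamma> i")
    case True
    then obtain i where "i \<in> {1..n}" "y \<in> \<gamma> i" by blast
    then show ?thesis
      using deg_gamma card_le by (simp add: diff_le_mono2)
  next
    case False
    then show ?thesis
      using deg_outside[OF that] A2 by (simp add: diff_le_mono2)
  qed
  have min: "wzd_min_degree R = enat (N - A)"
  proof (rule antisym)
    obtain y where y: "y \<in> \<gamma> m"
      using gamma_nonempty[OF m(1)] by blast
    show "wzd_min_degree R \<le> enat (N - A)"
      unfolding wzd_min_degree_def
      using INF_lower[OF gamma_vertex[OF m(1) y], of "wzd_degree R"] deg_gamma[OF m(1) y] m(2)
      by simp
    show "enat (N - A) \<le> wzd_min_degree R"
      unfolding wzd_min_degree_def using deg_ge by (intro INF_greatest)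
  qed
  show ?thesis
  proof (cases "\<exists>i\<in>{1..n}. x \<in> \<gamma> i")
    case True
    then obtain i where i: "i \<in> {1..n}" "x \<in> \<gamma> i" by blast
    have "wzd_degree R x = wzd_min_degree R \<longleftrightarrow> card (\<gamma> i) = A"
      using deg_gamma[OF i] min card_le[OF i(1)] AN by auto
    moreover have "(\<exists>j \<in> max_indices n p. x \<in> \<gamma> j) \<longleftrightarrow> card (\<gamma> i) = A"
      using i gamma_disjoint max_iff by metis
    ultimately show ?thesis by simp
  next
    case False
    then have "wzd_degree R x \<noteq> wzd_min_degree R"
      using deg_outside[OF x] min A2 AN by auto
    then show ?thesis
      using False max_iff by blast
  qed
qed

end

section \<open>Vertices of minimum degree\<close>

theorem theorem3p12:
  fixes R :: "('a, 'b) ring_scheme" (structure)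
    and n :: nat and p :: "nat \<Rightarrow> 'a set" and x :: 'a
  assumes "cring R" and "reduced R"
    and "n \<ge> 3" and "bij_betw p {1..n} (minimal_primes R)"
    and "alpha_max n p \<ge> 2" and "alpha_max n p \<noteq> \<infinity>"
    and "x \<in> nonzero_zero_divisors R"
  shows "wzd_degree R x = wzd_min_degree R \<longleftrightarrow>
    (\<exists>i \<in> max_indices n p. x \<in> prime_gamma n p i)"
proof -
  interpret cring R by fact
  have range: "p ` {1..n} = minimal_primes R" and inj: "inj_on p {1..n}"
    using assms(4) by (auto simp: bij_betw_def)
  have min: "p i \<in> minimal_primes R" if "i \<in> {1..n}" for i
    using that range by blast
  interpret incomparable_primes R n p
  proof (intro incomparable_primes.intro incomparable_primes_axioms.intro is_cring)
    show "2 \<le> n"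
      using assms(3) by simp
    show "primeideal (p i) R" if "i \<in> {1..n}" for i
      using min[OF that] by (simp add: minimal_primes_def)
    show "\<not> p i \<subseteq> p j" if "i \<in> {1..n}" "j \<in> {1..n}" "i \<noteq> j" for i j
    proof
      assume "p i \<subseteq> p j"
      then have "p i = p j"
        using min[OF that(1)] min[OF that(2)] by (simp add: minimal_primes_def)
      then show False
        using inj that by (simp add: inj_on_eq_iff)
    qed
    show "a = \<zero>" if "a \<in> carrier R" "\<And>i. i \<in> {1..n} \<Longrightarrow> a \<in> p i" for a
      using minimal_prime_avoiding[OF assms(2) that(1)] that(2) range by blast
  qed
  show ?thesis
    using assms(5-7) by (rule degree_minimal_iff)
qed

end
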